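(* Let $C\subset\mathbb{R}^n$ ($n\ge 2$) be a pointed closed convex cone with nonempty interior, let $\mathfrak v$ be a unit vector with $\mathfrak v\in\operatorname{int}C$ and $-\mathfrak v\in\operatorname{int}C^\circ$, and let $K$ be a $C$-pseudo-cone. Then there is a constant $c$, depending only on $C$, $\mathfrak v$ and $K$, such that $$ V_K(\omega)\le \frac{c}{\Delta(\omega)^{n-1}}$$ for every compact set $\omega\subset\Omega_{C^\circ}$, where $V_K$ is the cone-volume measure of $K$ and $\Delta(\omega)$ is the spherical distance of $\omega$ from the boundary of $\Omega_{C^\circ}$.
   Context: Work in Euclidean space $\mathbb{R}^n$, $n\ge 2$, with scalar product $\langle\cdot,\cdot\rangle$, origin $o$ and unit sphere $\mathbb{S}^{n-1}$; $\mathcal{H}^k$ is $k$-dimensional Hausdorff measure. A pseudo-cone is a nonempty closed convex set $K\subset\mathbb{R}^n$ with $o\notin K$ and $\lambda K\subseteq K$ for all $\lambda\ge 1$. Its recession cone is $\{z\in\mathbb{R}^n: K+\lambda z\subseteq K\ \forall\lambda\ge 0\}$, and $K$ is a $C$-pseudo-cone if its recession cone is $C$; then $K\subset C$. The dual cone is $C^\circ=\{x\in\mathbb{R}^n:\langle x,y\rangle\le 0\ \forall y\in C\}$, and $\Omega_{C^\circ}:=\mathbb{S}^{n-1}\cap\operatorname{int}C^\circ$. For $\omega\subset\Omega_{C^\circ}$, $$\Delta(\omega):=\inf\{\angle(u,v): u\in\omega,\ v\in\partial\Omega_{C^\circ}\},$$ where $\angle(u,v)\in[0,\pi]$ is the angle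 between $u$ and $v$ and $\partial\Omega_{C^\circ}$ is the boundary of $\Omega_{C^\circ}$ in $\mathbb{S}^{n-1}$ (with $\inf\emptyset=+\infty$ and $c/\infty=0$). For a $C$-pseudo-cone $K$, $\nu_K(x)$ denotes the outer unit normal vector of $K$ at those points $x\in\partial K$ where it is unique ($\mathcal{H}^{n-1}$-almost all points of $\partial K$), and $\nu_K^{-1}(\omega)$ is the set of such $x$ with $\nu_K(x)\in\omega$. The cone-volume measure of $K$ is the Borel measure on $\Omega_{C^\circ}$ given by $$V_K(\omega):=\mathcal{H}^n\Big(\bigcup_{x\in\nu_K^{-1}(\omega)}[o,x]\Big)$$ for Borel sets $\omega\subset\Omega_{C^\circ}$, where $[o,x]$ is the closed segment with endpoints $o$ and $x$. *)

theory Defs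
  imports "HOL-Analysis.Analysis"
begin

(* Hausdorff outer measure in the normalization that makes the measure of exponent DIM('a) agree
   with Lebesgue measure.  Covering sets must be bounded, because the library leaves the diameter
   of an unbounded set unspecified; empty covering sets weigh 0 even for k = 0, where 0 ^ 0 = 1. *)

definition hausdorff_weight :: "nat \<Rightarrow> 'a::metric_space set \<Rightarrow> ennreal" where
  "hausdorff_weight k E =
     (if E = {} then 0 else ennreal (unit_ball_vol (real k) * (diameter E / 2) ^ k))"

definition hausdorff_premeasure :: "nat \<Rightarrow> real \<Rightarrow> 'a::metric_space set \<Rightarrow> ennreal" where
  "hausdorff_premeasure k \<delta> A =
     (INF E \<in> {E :: nat \<Rightarrow> 'a set. A \<subseteq> (\<Union>i. E i) \<and> (\<forall>i. bounded (E i) \<and> diameter (E i) \<le> \<delta>)}.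
        (\<Sum>i. hausdorff_weight k (E i)))"

definition hausdorff_measure :: "nat \<Rightarrow> 'a::metric_space set \<Rightarrow> ennreal" where
  "hausdorff_measure k A = (SUP \<delta> \<in> {0<..}. hausdorff_premeasure k \<delta> A)"


definition recession_cone :: "'a::real_vector set \<Rightarrow> 'a set" where
  "recession_cone K = {z. \<forall>l\<ge>0. (\<lambda>x. x + l *\<^sub>R z) ` K \<subseteq> K}"

definition pseudo_cone :: "'a::euclidean_space set \<Rightarrow> bool" where
  "pseudo_cone K \<longleftrightarrow>
     K \<noteq> {} \<and> closed K \<and> convex K \<and> 0 \<notin> K \<and> (\<forall>l\<ge>1. (*\<^sub>R) l ` K \<subseteq> K)"

definition pseudo_cone_of :: "'a::euclidean_space set \<Rightarrow> 'a set \<Rightarrow> bool" where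
  "pseudo_cone_of C K \<longleftrightarrow> pseudo_cone K \<and> recession_cone K = C"

definition pointed :: "'a::real_vector set \<Rightarrow> bool" where
  "pointed C \<longleftrightarrow> C \<inter> uminus ` C = {0}"

definition dual_cone :: "'a::real_inner set \<Rightarrow> 'a set" where
  "dual_cone C = {x. \<forall>y\<in>C. x \<bullet> y \<le> 0}"

definition Omega_dual :: "'a::euclidean_space set \<Rightarrow> 'a set" where
  "Omega_dual C = sphere 0 1 \<inter> interior (dual_cone C)"

definition vector_angle :: "'a::real_inner \<Rightarrow> 'a \<Rightarrow> real" where
  "vector_angle u v = arccos (u \<bullet> v / (norm u * norm v))"

(* The boundary is taken in the sphere; the infimum of the empty set is top. *)
definition boundary_angle :: "'a::euclidean_space set \<Rightarrow> 'a set \<Rightarrow> ennreal" where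
  "boundary_angle C \<omega> =
     (INF (u, v) \<in> \<omega> \<times> (top_of_set (sphere 0 1) frontier_of (Omega_dual C)).
        ennreal (vector_angle u v))"


definition outer_unit_normal :: "'a::euclidean_space set \<Rightarrow> 'a \<Rightarrow> 'a \<Rightarrow> bool" where
  "outer_unit_normal K x u \<longleftrightarrow> norm u = 1 \<and> (\<forall>y\<in>K. (y - x) \<bullet> u \<le> 0)"

(* Only meaningful where the outer unit normal vector is unique. *)
definition gauss_map :: "'a::euclidean_space set \<Rightarrow> 'a \<Rightarrow> 'a" where
  "gauss_map K x = (THE u. outer_unit_normal K x u)"

definition reverse_gauss_image :: "'a::euclidean_space set \<Rightarrow> 'a set \<Rightarrow> 'a set" where
  "reverse_gauss_image K \<omega> =
     {x \<in> frontier K. (\<exists>!u. outer_unit_normal K x u) \<and> gauss_map K x \<in> \<omega>}"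

definition cone_volume :: "'a::euclidean_space set \<Rightarrow> 'a set \<Rightarrow> ennreal" where
  "cone_volume K \<omega> =
     hausdorff_measure DIM('a) (\<Union>x \<in> reverse_gauss_image K \<omega>. closed_segment 0 x)"

end

theory Submission
  imports Defs
begin

text \<open>
  If \<open>x\<close> has outer normal \<open>u \<in> \<omega>\<close>, then \<open>\<langle>x, u\<rangle> \<ge> \<langle>z, u\<rangle> \<ge> -\<bar>z\<bar>\<close> for a fixed \<open>z \<in> K\<close>, while a ball around \<open>u\<close>
  whose radius is comparable to \<open>\<Delta>(\<omega>)\<close> lies in the dual cone, so that \<open>\<langle>x, u\<rangle> \<le> - const \<Delta>(\<omega>) \<bar>x\<bar>\<close>.
  Hence \<open>\<bar>x\<bar> < R\<close> with \<open>R = const / \<Delta>(\<omega>)\<close>. Since \<open>z + C \<subseteq> K\<close>, the segments \<open>[0, x]\<close> avoid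
  \<open>z + int C\<close> and therefore lie in a layer of bounded thickness along the boundary of \<open>C\<close>.
  A fixed multiple of \<open>v\<close> translates the \<open>R\<close>-bounded part of the layer off itself, so about
  \<open>R\<close> disjoint translates fit into a ball of radius proportional to \<open>R\<close>; thus its volume
  is of order \<open>R\<close> to the power \<open>n - 1\<close>.
\<close>

subsection \<open>Hausdorff measure and Lebesgue measure\<close>

lemma norm_le_DIM_sup:
  fixes x :: "'a::euclidean_space"
  assumes "\<And>i. i \<in> Basis \<Longrightarrow> \<bar>x \<bullet> i\<bar> \<le> s"
  shows "norm x \<le> real DIM('a) * s"
proof -
  have "norm x \<le> (\<Sum>b\<in>Basis. \<bar>x \<bullet> b\<bar>)" by (rule norm_le_l1)
  also have "\<dots> \<le> (\<Sum>b\<in>(Basis::'a set). s)" by (rule sum_mono) (use assms in auto)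
  finally show ?thesis by simp
qed

text \<open>A cube of side \<open>s\<close> has volume \<open>s ^ n\<close> and, by the l1 bound on
  the norm, diameter at most \<open>n * s\<close>. The resulting constant is crude, which is
  harmless because constants depending only on the dimension are absorbed in the end.\<close>

lemma hausdorff_weight_cube_le:
  fixes u v :: "'a::euclidean_space"
  assumes s: "0 \<le> s" "\<And>i. i \<in> Basis \<Longrightarrow> v \<bullet> i - u \<bullet> i = s"
  shows "hausdorff_weight DIM('a) (cbox u v)
    \<le> ennreal (unit_ball_vol (real DIM('a)) * real DIM('a) ^ DIM('a)) * emeasure lborel (cbox u v)"
proof -
  have em: "emeasure lborel (cbox u v) = ennreal (s ^ DIM('a))"
  proof (subst emeasure_lborel_cbox)
    show "u \<bullet> b \<le> v \<bullet> b" if "b \<in> Basis" for b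
      using s(1) s(2)[OF that] by linarith
  qed (use s in \<open>auto simp: inner_diff_left\<close>)
  have d: "diameter (cbox u v) \<le> real DIM('a) * s"
  proof (rule diameter_le)
    fix x y assume xy: "x \<in> cbox u v" "y \<in> cbox u v"
    show "norm (x - y) \<le> real DIM('a) * s"
    proof (rule norm_le_DIM_sup)
      fix i :: 'a assume "i \<in> Basis"
      then show "\<bar>(x - y) \<bullet> i\<bar> \<le> s"
        using xy s(2)[of i] by (auto simp: mem_box inner_diff_left abs_le_iff dest!: bspec[of _ _ i])
    qed
  qed (use s in auto)
  have "(diameter (cbox u v) / 2) ^ DIM('a) \<le> (real DIM('a) * s) ^ DIM('a)"
    by (rule power_mono) (use d diameter_ge_0[of "cbox u v"] in auto)
  then have "unit_ball_vol (real DIM('a)) * (diameter (cbox u v) / 2) ^ DIM('a)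
     \<le> (unit_ball_vol (real DIM('a)) * real DIM('a) ^ DIM('a)) * s ^ DIM('a)"
    by (auto simp: power_mult_distrib mult.assoc intro!: mult_left_mono)
  then show ?thesis
    unfolding hausdorff_weight_def em
    using s(1) by (auto simp: ennreal_mult[symmetric] intro!: ennreal_leI)
qed

lemma hausdorff_premeasure_le_lborel:
  fixes S U :: "'a::euclidean_space set"
  assumes S: "S \<subseteq> U" and U: "open U" "bounded U" and "\<delta> > 0"
  shows "hausdorff_premeasure DIM('a) \<delta> S
    \<le> ennreal (unit_ball_vol (real DIM('a)) * real DIM('a) ^ DIM('a)) * emeasure lborel U"
proof -
  let ?c = "ennreal (unit_ball_vol (real DIM('a)) * real DIM('a) ^ DIM('a))"
  obtain B where B: "B > 0" "\<And>x. x \<in> U \<Longrightarrow> norm x \<le> B"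
    using U(2) bounded_pos by blast
  let ?b = "B *\<^sub>R One :: 'a"
  have sub: "S \<subseteq> cbox (- ?b) ?b"
  proof
    fix x assume "x \<in> S"
    then have n: "norm x \<le> B" using S B by auto
    show "x \<in> cbox (- ?b) ?b"
    proof (simp add: mem_box, intro ballI)
      fix i :: 'a assume i: "i \<in> Basis"
      have "\<bar>x \<bullet> i\<bar> \<le> B" using Basis_le_norm[OF i, of x] n by linarith
      then show "- B \<le> x \<bullet> i \<and> x \<bullet> i \<le> B" by linarith
    qed
  qed
  have ne: "box (- ?b) ?b \<noteq> {}"
    using B(1) by (auto simp: box_ne_empty)
  \<comment> \<open>Radius at most \<open>\<delta> / 2\<close> forces diameter at most
    \<open>\<delta>\<close>. Outside \<open>U\<close> any such radius will do, since every cube is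
    tagged by a point of \<open>S\<close>, which lies in \<open>U\<close>.\<close>
  have "\<forall>x. \<exists>e>0. e \<le> \<delta> / 2 \<and> (x \<in> U \<longrightarrow> ball x e \<subseteq> U)"
  proof
    fix x
    show "\<exists>e>0. e \<le> \<delta> / 2 \<and> (x \<in> U \<longrightarrow> ball x e \<subseteq> U)"
    proof (cases "x \<in> U")
      case True
      then obtain e where "e > 0" "ball x e \<subseteq> U" using U(1) open_contains_ball by blast
      then show ?thesis using \<open>\<delta> > 0\<close> by (intro exI[of _ "min e (\<delta>/2)"]) auto
    next
      case False
      then show ?thesis using \<open>\<delta> > 0\<close> by (intro exI[of _ "\<delta>/2"]) auto
    qed
  qed
  then obtain e where e: "\<And>x. e x > 0" "\<And>x. e x \<le> \<delta> / 2"
      "\<And>x. x \<in> U \<Longrightarrow> ball x (e x) \<subseteq> U"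
    by metis
  have "gauge (\<lambda>x. ball x (e x))" using e(1) by (simp add: gauge_def)
  from covering_lemma[OF sub ne this] obtain \<D> where \<D>: "countable \<D>"
    "\<And>K. K \<in> \<D> \<Longrightarrow> interior K \<noteq> {} \<and> (\<exists>c d. K = cbox c d)"
    "pairwise (\<lambda>A B. interior A \<inter> interior B = {}) \<D>"
    "\<And>K. K \<in> \<D> \<Longrightarrow> \<exists>x \<in> S \<inter> K. K \<subseteq> ball x (e x)"
    "\<And>u v. cbox u v \<in> \<D> \<Longrightarrow> \<exists>n. \<forall>i \<in> Basis. v \<bullet> i - u \<bullet> i = (?b \<bullet> i - (- ?b) \<bullet> i) / 2^n"
    "S \<subseteq> \<Union>\<D>" by metis
  \<comment> \<open>The countable family is turned into a sequence, padded by empty sets, whose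
    weight is 0.\<close>
  define E where "E i = (if i \<in> to_nat_on \<D> ` \<D> then from_nat_into \<D> i else {})" for i
  have E_cases: "E i = {} \<or> E i \<in> \<D>" for i
    using \<D>(1) by (auto simp: E_def)
  have E_in: "K \<in> \<D> \<Longrightarrow> K = E (to_nat_on \<D> K)" for K
    using \<D>(1) by (auto simp: E_def)
  have E_cover: "S \<subseteq> (\<Union>i. E i)" using \<D>(6) E_in by blast
  have E_ball: "\<exists>x\<in>S. E i \<subseteq> ball x (e x)" if "E i \<noteq> {}" for i
    using E_cases[of i] that \<D>(4) by blast
  have E_U: "E i \<subseteq> U" for i using E_ball[of i] e(3) S by blast
  have E_small: "bounded (E i) \<and> diameter (E i) \<le> \<delta>" for i
  proof (cases "E i = {}")
    case False
    then obtain x where x: "E i \<subseteq> ball x (e x)" using E_ball by blast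
    have "diameter (E i) \<le> diameter (ball x (e x))" by (rule diameter_subset[OF x bounded_ball])
    also have "\<dots> \<le> \<delta>" using e(1,2)[of x] by (simp add: diameter_ball)
    finally show ?thesis using x bounded_subset bounded_ball by blast
  qed (use \<open>\<delta> > 0\<close> in auto)
  \<comment> \<open>Neighbouring cubes may share faces, so disjointness holds only for interiors; no
    volume is lost, as the faces are null sets.\<close>
  have E_disj: "disjoint_family (\<lambda>i. interior (E i))"
    unfolding disjoint_family_on_def
  proof (intro ballI impI)
    fix i j :: nat assume "i \<noteq> j"
    show "interior (E i) \<inter> interior (E j) = {}"
    proof (cases "i \<in> to_nat_on \<D> ` \<D> \<and> j \<in> to_nat_on \<D> ` \<D>")
      case True
      then have "E i \<in> \<D>" "E j \<in> \<D>" "E i \<noteq> E j"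
        using \<open>i \<noteq> j\<close> \<D>(1) by (auto simp: E_def)
      then show ?thesis using \<D>(3) by (auto simp: pairwise_def)
    qed (auto simp: E_def)
  qed
  have weight: "hausdorff_weight DIM('a) (E i) \<le> ?c * emeasure lborel (interior (E i))" for i
  proof (cases "E i = {}")
    case False
    then have "E i \<in> \<D>" using E_cases by blast
    then obtain u v where uv: "E i = cbox u v" using \<D>(2) by blast
    then obtain n where n: "\<And>k. k \<in> Basis \<Longrightarrow> v \<bullet> k - u \<bullet> k = (?b \<bullet> k - (- ?b) \<bullet> k) / 2^n"
      using \<D>(5) \<open>E i \<in> \<D>\<close> by metis
    have n': "v \<bullet> k - u \<bullet> k = 2 * B / 2 ^ n" if "k \<in> Basis" for k
      using n[OF that] that by simp
    have le: "u \<bullet> k \<le> v \<bullet> k" if "k \<in> Basis" for k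
      using n'[OF that] B(1) by (metis diff_ge_0_iff_ge divide_nonneg_nonneg less_eq_real_def mult_nonneg_nonneg zero_le_numeral zero_le_power)
    have "emeasure lborel (interior (E i)) = emeasure lborel (cbox u v)"
      unfolding uv interior_cbox using le by simp
    then show ?thesis
      using hausdorff_weight_cube_le[of "2 * B / 2 ^ n" v u] n' B(1) uv by simp
  qed (simp add: hausdorff_weight_def)
  have "hausdorff_premeasure DIM('a) \<delta> S \<le> (\<Sum>i. hausdorff_weight DIM('a) (E i))"
    unfolding hausdorff_premeasure_def
    by (rule INF_lower) (use E_cover E_small in auto)
  also have "\<dots> \<le> (\<Sum>i. ?c * emeasure lborel (interior (E i)))"
    by (intro suminf_le weight) auto
  also have "\<dots> = ?c * (\<Sum>i. emeasure lborel (interior (E i)))"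
    by (rule ennreal_suminf_cmult)
  also have "(\<Sum>i. emeasure lborel (interior (E i))) = emeasure lborel (\<Union>i. interior (E i))"
    by (rule suminf_emeasure[OF _ E_disj]) auto
  also have "\<dots> \<le> emeasure lborel U"
    by (rule emeasure_mono) (use E_U interior_subset U in \<open>fastforce+\<close>)
  finally show ?thesis by (simp add: mult_left_mono)
qed

lemma hausdorff_measure_le_lborel:
  fixes S U :: "'a::euclidean_space set"
  assumes "S \<subseteq> U" "open U" "bounded U"
  shows "hausdorff_measure DIM('a) S
    \<le> ennreal (unit_ball_vol (real DIM('a)) * real DIM('a) ^ DIM('a)) * emeasure lborel U"
  unfolding hausdorff_measure_def
  by (rule SUP_least) (use hausdorff_premeasure_le_lborel[OF assms] in auto)

lemma hausdorff_measure_empty [simp]: "hausdorff_measure k ({} :: 'a::metric_space set) = 0"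
proof -
  have "hausdorff_premeasure k \<delta> ({} :: 'a set) = 0" if "\<delta> > 0" for \<delta> :: real
  proof -
    have "hausdorff_premeasure k \<delta> ({} :: 'a set) \<le> (\<Sum>i::nat. hausdorff_weight k ({} :: 'a set))"
      unfolding hausdorff_premeasure_def
      by (rule INF_lower2[of "\<lambda>_. {}"]) (use that in auto)
    then show ?thesis by (simp add: hausdorff_weight_def)
  qed
  then show ?thesis by (auto simp: hausdorff_measure_def intro!: SUP_eq_const)
qed

subsection \<open>Angular distance to the boundary of the dual cone\<close>

text \<open>Taylor's estimate gives \<open>sin x >= x - x ^ 3 / 6\<close>, and
  \<open>x * x <= 3\<close> because \<open>pi / 2\<close> is below \<open>17/10\<close>.\<close>

lemma half_le_sin:
  fixes x :: real
  assumes "0 \<le> x" "x \<le> pi / 2"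
  shows "x / 2 \<le> sin x"
proof -
  have "\<bar>sin x - (\<Sum>m<3. sin_coeff m * x ^ m)\<bar> \<le> inverse (fact 3) * \<bar>x\<bar> ^ 3"
    by (rule Maclaurin_sin_bound)
  moreover have "(\<Sum>m<3. sin_coeff m * x ^ m) = x"
    by (simp add: numeral_3_eq_3 sin_coeff_def)
  moreover have "fact 3 = (6 :: real)" by (simp add: fact_numeral)
  ultimately have 1: "\<bar>sin x - x\<bar> \<le> x ^ 3 / 6"
    using assms(1) by simp
  have "x \<le> 17/10" using assms pi_approx by simp
  then have "x * x \<le> 3"
    using mult_mono[of x "17/10" x "17/10"] assms by simp
  then have "x * (x * x) \<le> x * 3" using assms by (intro mult_left_mono) auto
  then show ?thesis using 1 unfolding power3_eq_cube mult.assoc by linarith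
qed

text \<open>The chord belonging to an angle \<open>t\<close> has length
  \<open>2 * sin (t / 2)\<close>, which is at least \<open>t / 2\<close> by
  \<open>half_le_sin\<close>.\<close>

lemma vector_angle_le_norm_diff:
  fixes u q :: "'a::real_inner"
  assumes "norm u = 1" "norm q = 1"
  shows "vector_angle u q \<le> 2 * norm (u - q)"
proof -
  let ?t = "vector_angle u q"
  have b: "\<bar>u \<bullet> q\<bar> \<le> 1" using Cauchy_Schwarz_ineq2[of u q] assms by simp
  have t: "0 \<le> ?t" "?t \<le> pi" "cos ?t = u \<bullet> q"
    using b assms by (simp_all add: vector_angle_def abs_le_iff arccos_lbound arccos_ubound)
  have uu: "u \<bullet> u = 1" "q \<bullet> q = 1" using assms by (simp_all add: dot_square_norm)
  have "(norm (u - q))\<^sup>2 = 2 - 2 * (u \<bullet> q)"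
    unfolding power2_norm_eq_inner inner_diff_left inner_diff_right uu inner_commute[of q u]
    by simp
  also have "u \<bullet> q = 1 - 2 * (sin (?t / 2))\<^sup>2"
    using cos_double_sin[of "?t / 2"] unfolding t(3)[symmetric] by simp
  also have "2 - 2 * (1 - 2 * (sin (?t / 2))\<^sup>2) = (2 * sin (?t / 2))\<^sup>2"
    by (simp add: power_mult_distrib)
  finally have "norm (u - q) = 2 * sin (?t / 2)"
  proof (rule power2_eq_imp_eq)
    show "0 \<le> 2 * sin (?t / 2)" using sin_ge_zero[of "?t / 2"] t(1,2) by linarith
  qed simp
  then show ?thesis using half_le_sin[of "?t / 2"] t(1,2) by linarith
qed

text \<open>Projecting \<open>p\<close> radially to the sphere moves it by the difference of the
  norms of \<open>p\<close> and \<open>u\<close>, which is at most \<open>norm (u - p)\<close>; the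
  triangle inequality gives the factor 2.\<close>

lemma norm_normalize_diff_le:
  fixes u p :: "'a::real_normed_vector"
  assumes "norm u = 1" "p \<noteq> 0"
  shows "norm (u - p /\<^sub>R norm p) \<le> 2 * norm (u - p)"
proof -
  have "(norm p - 1) / norm p = 1 - inverse (norm p)"
    using assms by (simp add: field_simps)
  then have "p - p /\<^sub>R norm p = ((norm p - 1) / norm p) *\<^sub>R p"
    by (simp add: scaleR_diff_left)
  then have "norm (p - p /\<^sub>R norm p) = \<bar>norm p - norm u\<bar>"
    using assms by simp
  also have "\<dots> \<le> norm (u - p)" by (metis norm_minus_commute norm_triangle_ineq3)
  finally show ?thesis
    using norm_triangle_ineq[of "u - p" "p - p /\<^sub>R norm p"] by simp
qed

lemma scaleR_interior_dual_cone:
  assumes "x \<in> interior (dual_cone C)" "c > 0"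
  shows "c *\<^sub>R x \<in> interior (dual_cone C)"
proof -
  have "(*\<^sub>R) c ` dual_cone C \<subseteq> dual_cone C"
    using assms(2) by (auto simp: dual_cone_def mult_nonneg_nonpos)
  then have "(*\<^sub>R) c ` interior (dual_cone C) \<subseteq> interior (dual_cone C)"
    using assms(2) by (intro interior_maximal) (auto simp: open_scaling dest: interior_subset[THEN subsetD])
  then show ?thesis using assms(1) by auto
qed

text \<open>Were the ball to leave the dual cone, its radial projection would be a connected part of
  the sphere meeting both \<open>Omega_dual C\<close> and its complement, hence containing a
  boundary point \<open>q\<close>. The two preceding estimates each lose a factor 2, so the angle
  between \<open>u\<close> and \<open>q\<close> would be less than \<open>4 * r\<close>. The bound
  \<open>r < 1\<close> keeps the origin out of the ball.\<close>

lemma ball_subset_dual_cone: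
  fixes C :: "'a::euclidean_space set"
  assumes u: "u \<in> \<omega>" "\<omega> \<subseteq> Omega_dual C" and r: "r < 1"
    and ang: "ennreal (4 * r) \<le> boundary_angle C \<omega>"
  shows "ball u r \<subseteq> dual_cone C"
proof (rule ccontr)
  assume "\<not> ball u r \<subseteq> dual_cone C"
  then obtain w where w: "w \<in> ball u r" "w \<notin> dual_cone C" by blast
  then have "r > 0" by (auto simp: dist_norm intro: le_less_trans[OF norm_ge_zero])
  have nu: "norm u = 1" and uI: "u \<in> interior (dual_cone C)"
    using u by (auto simp: Omega_dual_def)
  have nz: "p \<noteq> 0" if "p \<in> ball u r" for p
    using that r nu by (auto simp: dist_norm)
  let ?N = "\<lambda>p::'a. p /\<^sub>R norm p"
  have "connected (?N ` ball u r)"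
    by (intro connected_continuous_image continuous_intros convex_connected convex_ball)
       (use nz in auto)
  moreover have "?N ` ball u r \<subseteq> sphere 0 1" using nz by (auto simp: field_simps)
  ultimately have "connectedin (top_of_set (sphere 0 1)) (?N ` ball u r)"
    by (simp add: connectedin_subtopology)
  moreover have "?N u \<in> ?N ` ball u r \<inter> Omega_dual C"
  proof
    show "?N u \<in> ?N ` ball u r" using \<open>r > 0\<close> by (intro imageI) auto
  qed (use nu uI in \<open>auto simp: Omega_dual_def\<close>)
  moreover have "?N w \<notin> Omega_dual C"
  proof
    assume "?N w \<in> Omega_dual C"
    then have "?N w \<in> interior (dual_cone C)" by (simp add: Omega_dual_def)
    then have "norm w *\<^sub>R ?N w \<in> interior (dual_cone C)"
      by (rule scaleR_interior_dual_cone) (use nz[OF w(1)] in simp)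
    moreover have "norm w *\<^sub>R ?N w = w" using nz[OF w(1)] by simp
    ultimately show False using w(2) interior_subset by auto
  qed
  ultimately obtain q where q: "q \<in> ?N ` ball u r"
      "q \<in> top_of_set (sphere 0 1) frontier_of (Omega_dual C)"
    using connectedin_Int_frontier_of[of _ "?N ` ball u r" "Omega_dual C"] w(1) by blast
  then obtain p where p: "p \<in> ball u r" "q = ?N p" by auto
  have "boundary_angle C \<omega> \<le> ennreal (vector_angle u q)"
    unfolding boundary_angle_def by (rule INF_lower2[of "(u, q)"]) (use u q in auto)
  with ang have "ennreal (4 * r) \<le> ennreal (vector_angle u q)" by (rule order_trans)
  then have "4 * r \<le> vector_angle u q"
    using \<open>r > 0\<close> by (simp add: ennreal_le_iff2)
  also have "\<dots> \<le> 2 * norm (u - q)"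
    using p nz nu by (intro vector_angle_le_norm_diff) auto
  also have "\<dots> \<le> 4 * norm (u - p)"
    using norm_normalize_diff_le[OF nu nz[OF p(1)]] p(2) by simp
  also have "\<dots> < 4 * r" using p(1) by (simp add: dist_norm)
  finally show False by simp
qed

text \<open>The sphere is connected in dimension at least 2, contains \<open>u\<close> in
  \<open>Omega_dual C\<close> and \<open>v\<close> outside it, so the boundary is nonempty and the
  infimum is finite.\<close>

lemma boundary_angle_le_pi:
  fixes C :: "'a::euclidean_space set"
  assumes "DIM('a) \<ge> 2" "u \<in> \<omega>" "\<omega> \<subseteq> Omega_dual C" "v \<in> C" "norm v = 1"
  shows "boundary_angle C \<omega> \<le> ennreal pi"
proof -
  let ?F = "top_of_set (sphere 0 1) frontier_of (Omega_dual C)"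
  have "v \<notin> dual_cone C"
  proof
    assume "v \<in> dual_cone C"
    then have "v \<bullet> v \<le> 0" using assms(4) by (simp add: dual_cone_def)
    then show False using assms(5) power2_norm_eq_inner[of v] by simp
  qed
  then have "v \<in> sphere 0 1 - Omega_dual C"
    using assms interior_subset by (auto simp: Omega_dual_def)
  moreover have "u \<in> sphere 0 1 \<inter> Omega_dual C" using assms by (auto simp: Omega_dual_def)
  moreover have "connectedin (top_of_set (sphere 0 1)) (sphere (0::'a) 1)"
    using connected_sphere[OF assms(1)] by (simp add: connectedin_subtopology)
  ultimately obtain q where q: "q \<in> ?F"
    using connectedin_Int_frontier_of[of _ "sphere 0 1" "Omega_dual C"] by blast
  then have nq: "norm q = 1" using frontier_of_subset_subtopology[of euclidean "sphere (0::'a) 1" "Omega_dual C"] by auto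
  have nu: "norm u = 1" using assms by (auto simp: Omega_dual_def)
  have "\<bar>u \<bullet> q\<bar> \<le> 1" using Cauchy_Schwarz_ineq2[of u q] nu nq by simp
  then have "vector_angle u q \<le> pi"
    using nu nq by (auto simp: vector_angle_def abs_le_iff arccos_ubound)
  then show ?thesis unfolding boundary_angle_def
    by (intro INF_lower2[of "(u, q)"]) (use assms q in \<open>auto intro: ennreal_leI\<close>)
qed

subsection \<open>Pseudo-cones and the boundary layer of the recession cone\<close>

text \<open>The translate of \<open>interior C\<close> by \<open>x\<close> is an open subset of
  \<open>C\<close>.\<close>

lemma convex_cone_add_interior:
  fixes C :: "'a::real_normed_vector set"
  assumes "convex_cone C" "x \<in> C" "y \<in> interior C"
  shows "x + y \<in> interior C"
proof -
  have "(+) x ` interior C \<subseteq> C"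
    using assms interior_subset[of C] by (auto intro: convex_cone_add)
  then have "(+) x ` interior C \<subseteq> interior C"
    by (intro interior_maximal) (auto intro!: open_translation simp del: image_add_0)
  then show ?thesis using assms by auto
qed

lemma scaleR_minus_in_convex_cone:
  fixes C :: "'a::real_normed_vector set"
  assumes "convex_cone C" "ball v e \<subseteq> C" "norm z < t * e" "0 < t"
  shows "t *\<^sub>R v - z \<in> C"
proof -
  have "v - z /\<^sub>R t \<in> ball v e" using assms by (simp add: dist_norm field_simps)
  then have "t *\<^sub>R (v - z /\<^sub>R t) \<in> C"
    using assms by (intro convex_cone_scaleR) auto
  then show ?thesis using assms by (simp add: algebra_simps)
qed

text \<open>The point \<open>y + l x\<close> is the limit of the convex combinations of
  \<open>y\<close> and \<open>m l x\<close> with weights \<open>1 - 1/m\<close> and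
  \<open>1/m\<close>; here \<open>m l x\<close> is in \<open>K\<close> as soon as
  \<open>m l >= 1\<close>, and \<open>K\<close> is closed.\<close>

lemma pseudo_cone_subset_recession_cone:
  assumes "pseudo_cone K"
  shows "K \<subseteq> recession_cone K"
proof
  fix x assume x: "x \<in> K"
  have cl: "closed K" and cv: "convex K" and sc: "\<And>l y. l \<ge> 1 \<Longrightarrow> y \<in> K \<Longrightarrow> l *\<^sub>R y \<in> K"
    using assms by (auto simp: pseudo_cone_def)
  have "y + l *\<^sub>R x \<in> K" if y: "y \<in> K" and l: "l \<ge> 0" for y l
  proof (cases "l = 0")
    case False
    let ?t = "\<lambda>m::nat. inverse (real (Suc m))"
    have "\<forall>\<^sub>F m in sequentially. (1 - ?t m) *\<^sub>R y + l *\<^sub>R x \<in> K"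
    proof -
      have "\<forall>\<^sub>F m in sequentially. inverse l \<le> real (Suc m)"
        using eventually_ge_at_top[of "nat \<lceil>inverse l\<rceil>"] by eventually_elim linarith
      then show ?thesis
      proof eventually_elim
        case (elim m)
        then have "1 \<le> l * real (Suc m)" using l False by (simp add: field_simps)
        then have "(l * real (Suc m)) *\<^sub>R x \<in> K" using sc x by blast
        then have "(1 - ?t m) *\<^sub>R y + ?t m *\<^sub>R ((l * real (Suc m)) *\<^sub>R x) \<in> K"
          using y by (intro convexD[OF cv]) (auto simp: field_simps)
        moreover have "?t m *\<^sub>R ((l * real (Suc m)) *\<^sub>R x) = l *\<^sub>R x" by simp
        ultimately show ?case by (simp only:)
      qed
    qed
    moreover have "(\<lambda>m. (1 - ?t m) *\<^sub>R y + l *\<^sub>R x) \<longlonglongrightarrow> (1 - 0) *\<^sub>R y + l *\<^sub>R x"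
      by (intro tendsto_intros LIMSEQ_inverse_real_of_nat)
    ultimately show ?thesis
      using Lim_in_closed_set[OF cl] by fastforce
  qed (use y in simp)
  then show "x \<in> recession_cone K" by (auto simp: recession_cone_def)
qed

text \<open>
  The shifts by \<open>v\<close> make the layer open; without them it would be \<open>C - (z + interior C)\<close>.
\<close>
definition boundary_layer :: "'a::real_normed_vector set \<Rightarrow> 'a \<Rightarrow> 'a \<Rightarrow> real \<Rightarrow> 'a set" where
  "boundary_layer C v z R = {y. y + v \<in> interior C \<and> y - z - v \<notin> C \<and> norm y < R}"

lemma open_boundary_layer:
  assumes "closed C"
  shows "open (boundary_layer C v z R)"
proof -
  have "boundary_layer C v z R = (\<lambda>y. y + v) -` interior C \<inter> (\<lambda>y. y - z - v) -` (- C) \<inter> ball 0 R"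
    by (auto simp: boundary_layer_def)
  moreover have "open \<dots>"
    using assms by (intro open_Int open_vimage continuous_intros) auto
  ultimately show ?thesis by simp
qed

lemma boundary_layer_subset_ball: "boundary_layer C v z R \<subseteq> ball 0 R"
  by (auto simp: boundary_layer_def)

text \<open>Translating the layer by \<open>t v\<close> with \<open>t >= M\<close> moves it off
  itself. About \<open>R\<close> disjoint translates by multiples of \<open>M v\<close> fit into a
  ball of radius \<open>(1 + 2 * M) * R\<close>; comparing volumes and cancelling one factor
  \<open>R\<close> leaves the power \<open>n - 1\<close>.\<close>

lemma emeasure_boundary_layer_le:
  fixes C :: "'a::euclidean_space set"
  assumes C: "closed C" "convex_cone C" and v: "v \<in> interior C" "norm v = 1"
  obtains c where "c \<ge> 0"
    "\<And>R. R \<ge> 1 \<Longrightarrow> emeasure lborel (boundary_layer C v z R) \<le> ennreal (c * R ^ (DIM('a) - 1))"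
proof -
  obtain e where e: "e > 0" "ball v e \<subseteq> C"
    using v(1) by (auto simp: mem_interior)
  \<comment> \<open>The term \<open>norm z / e\<close> compensates the shift by \<open>z\<close>, 2
    compensates the two shifts by \<open>v\<close> in \<open>boundary_layer\<close>, and the
    remaining 1 gives a strict inequality. Thus \<open>M\<close> does not depend on
    \<open>R\<close>.\<close>
  define M where "M = 3 + norm z / e"
  have M: "M \<ge> 3" using e by (simp add: M_def)
  have shift: "t *\<^sub>R v - z - 2 *\<^sub>R v \<in> C" if "t \<ge> M" for t
  proof -
    have "(t - 2) *\<^sub>R v - z \<in> C"
    proof (rule scaleR_minus_in_convex_cone[OF C(2) e(2)])
      have "1 + norm z / e \<le> t - 2" using that by (simp add: M_def)
      then have "(1 + norm z / e) * e \<le> (t - 2) * e" using e by (intro mult_right_mono) auto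
      then show "norm z < (t - 2) * e" using e by (simp add: algebra_simps)
    qed (use that M in auto)
    then show ?thesis by (simp add: algebra_simps)
  qed
  have sep: "y + t *\<^sub>R v \<notin> boundary_layer C v z R"
    if "y \<in> boundary_layer C v z R" "t \<ge> M" for y t R
  proof
    assume "y + t *\<^sub>R v \<in> boundary_layer C v z R"
    then have "y + t *\<^sub>R v - z - v \<notin> C" by (simp add: boundary_layer_def)
    moreover have "y + v \<in> C" using that interior_subset by (auto simp: boundary_layer_def)
    then have "(y + v) + (t *\<^sub>R v - z - 2 *\<^sub>R v) \<in> C"
      by (rule convex_cone_add[OF C(2) _ shift[OF that(2)]])
    ultimately show False by (simp add: algebra_simps scaleR_2)
  qed
  define V where "V = unit_ball_vol (real DIM('a))"
  have V: "V \<ge> 0" by (simp add: V_def)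
  show thesis
  proof (rule that[of "V * (1 + 2 * M) ^ DIM('a)"])
    show "V * (1 + 2 * M) ^ DIM('a) \<ge> 0" using V M by simp
    fix R :: real assume R: "R \<ge> 1"
    let ?U = "boundary_layer C v z R"
    \<comment> \<open>At least \<open>R\<close> translates are needed to gain the factor
      \<open>R\<close>; \<open>N <= 2 * R\<close> holds because \<open>R >= 1\<close>, and keeps the
      union in a ball of radius proportional to \<open>R\<close>.\<close>
    define N where "N = nat \<lceil>R\<rceil>"
    have N: "R \<le> real N" "real N \<le> 2 * R" using R unfolding N_def by linarith+
    let ?T = "\<lambda>j::nat. (+) ((real j * M) *\<^sub>R v) ` ?U"
    have opU: "open ?U" by (rule open_boundary_layer[OF C(1)])
    have lmU: "?U \<in> lmeasurable"
      using opU bounded_subset[OF bounded_ball boundary_layer_subset_ball] by (intro lmeasurable_open)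
    have lm: "?T j \<in> lmeasurable" for j by (rule measurable_translation[OF lmU])
    have disj1: "?T i \<inter> ?T j = {}" if "i < j" for i j
    proof (rule ccontr)
      assume "?T i \<inter> ?T j \<noteq> {}"
      then obtain y y' where y: "y \<in> ?U" "y' \<in> ?U"
        "(real i * M) *\<^sub>R v + y' = (real j * M) *\<^sub>R v + y" by auto
      then have "y' = y + ((real j - real i) * M) *\<^sub>R v" by (simp add: algebra_simps)
      moreover have "M \<le> (real j - real i) * M"
        using that M mult_right_mono[of 1 "real j - real i" M] by simp
      ultimately show False using sep[OF y(1)] y(2) by blast
    qed
    have disj: "disjoint_family_on ?T {..<N}"
      unfolding disjoint_family_on_def using disj1 by (metis Int_commute linorder_neqE_nat)
    have sub: "(\<Union>j<N. ?T j) \<subseteq> ball 0 ((1 + 2 * M) * R)"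
    proof
      fix x assume "x \<in> (\<Union>j<N. ?T j)"
      then obtain j y where j: "j < N" "y \<in> ?U" "x = (real j * M) *\<^sub>R v + y" by auto
      have "norm x \<le> real j * M + norm y"
        using norm_triangle_ineq[of "(real j * M) *\<^sub>R v" y] v(2) M j(3) by simp
      also have "\<dots> < (2 * R) * M + R"
      proof (rule add_le_less_mono)
        show "real j * M \<le> 2 * R * M" using j(1) N M by (intro mult_right_mono) auto
        show "norm y < R" using j(2) by (simp add: boundary_layer_def)
      qed
      finally show "x \<in> ball 0 ((1 + 2 * M) * R)" by (simp add: algebra_simps)
    qed
    have "R * measure lebesgue ?U \<le> real N * measure lebesgue ?U"
      using N by (intro mult_right_mono) auto
    also have "\<dots> = (\<Sum>j<N. measure lebesgue (?T j))" by (simp add: measure_translation)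
    also have "\<dots> = measure lebesgue (\<Union>j<N. ?T j)"
    proof (rule measure_finite_Union[symmetric, OF _ _ disj])
      show "emeasure lebesgue (?T j) \<noteq> \<infinity>" for j
        unfolding infinity_ennreal_def by (rule fmeasurableD2[OF lm])
    qed (use fmeasurableD[OF lm] in blast)+
    also have "\<dots> \<le> measure lebesgue (ball (0::'a) ((1 + 2 * M) * R))"
      by (rule measure_mono_fmeasurable[OF sub]) (use lm in auto)
    also have "\<dots> = V * ((1 + 2 * M) * R) ^ DIM('a)"
      unfolding V_def using M R by (subst content_ball[symmetric]) auto
    also have "\<dots> = R * (V * (1 + 2 * M) ^ DIM('a) * R ^ (DIM('a) - 1))"
      by (simp add: power_mult_distrib mult_ac power_eq_if[of R "DIM('a)"])
    finally have "measure lebesgue ?U \<le> V * (1 + 2 * M) ^ DIM('a) * R ^ (DIM('a) - 1)"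
      using R by simp
    moreover have "emeasure lborel ?U = ennreal (measure lebesgue ?U)"
    proof -
      have "emeasure lborel ?U = emeasure lebesgue ?U" using opU by simp
      also have "\<dots> = ennreal (measure lebesgue ?U)"
        by (rule emeasure_eq_ennreal_measure[OF fmeasurableD2[OF lmU]])
      finally show ?thesis .
    qed
    ultimately show "emeasure lborel ?U \<le> ennreal (V * (1 + 2 * M) ^ DIM('a) * R ^ (DIM('a) - 1))"
      by (simp add: ennreal_leI)
  qed
qed

text \<open>Moving \<open>u\<close> by \<open>s\<close> in the direction of \<open>x\<close> stays
  in the dual cone; pairing the result with \<open>x\<close> gives
  \<open>s * norm x <= - (x \<bullet> u)\<close>. The support inequality at \<open>x\<close> bounds
  the right side by \<open>- (z \<bullet> u)\<close>, hence by \<open>norm z\<close>.\<close>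

lemma norm_le_of_ball_subset_dual_cone:
  fixes x u z :: "'a::euclidean_space"
  assumes x: "x \<in> C" and r: "ball u (2 * s) \<subseteq> dual_cone C" "s > 0"
    and u: "norm u = 1" "(z - x) \<bullet> u \<le> 0"
  shows "s * norm x \<le> norm z"
proof (cases "x = 0")
  case False
  have "u + (s / norm x) *\<^sub>R x \<in> ball u (2 * s)"
    using False r(2) by (simp add: dist_norm)
  then have "(u + (s / norm x) *\<^sub>R x) \<bullet> x \<le> 0"
    using r(1) x by (auto simp: dual_cone_def)
  then have "s * norm x \<le> - (x \<bullet> u)"
    using False unfolding inner_add_left inner_scaleR_left inner_commute[of u x] dot_square_norm
    by (simp add: power2_eq_square)
  also have "\<dots> \<le> - (z \<bullet> u)" using u(2) by (simp add: inner_diff_left)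
  also have "\<dots> \<le> norm z"
    using Cauchy_Schwarz_ineq2[of z u] u(1) by simp
  finally show ?thesis .
qed simp

text \<open>If \<open>y = t x\<close> violated the condition \<open>y - z - v \<notin> C\<close>,
  adding \<open>v\<close> and then \<open>(1 - t) x\<close> would put \<open>x\<close> into
  \<open>z + interior C\<close>, which lies in the interior of \<open>K\<close>; but
  \<open>x\<close> is a frontier point.\<close>

lemma closed_segment_subset_boundary_layer:
  assumes C: "convex_cone C" "v \<in> interior C" and K: "recession_cone K = C" "z \<in> K"
    and x: "x \<in> frontier K" "x \<in> C" "norm x < R"
  shows "closed_segment 0 x \<subseteq> boundary_layer C v z R"
proof
  fix y assume "y \<in> closed_segment 0 x"
  then obtain t where t: "0 \<le> t" "t \<le> 1" "y = t *\<^sub>R x" by (auto simp: in_segment)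
  have "z + w \<in> K" if "w \<in> C" for w
    using that K unfolding recession_cone_def by (auto dest!: spec[of _ "1::real"])
  then have "(+) z ` interior C \<subseteq> K" using interior_subset[of C] by blast
  then have zK: "(+) z ` interior C \<subseteq> interior K"
    by (intro interior_maximal) (auto intro!: open_translation simp del: image_add_0)
  have "y - z - v \<notin> C"
  proof
    assume "y - z - v \<in> C"
    then have "(y - z - v) + v \<in> interior C" by (rule convex_cone_add_interior[OF C(1) _ C(2)])
    moreover have "(1 - t) *\<^sub>R x \<in> C" using C x t by (intro convex_cone_scaleR) auto
    ultimately have "(1 - t) *\<^sub>R x + ((y - z - v) + v) \<in> interior C"
      by (intro convex_cone_add_interior[OF C(1), of "(1 - t) *\<^sub>R x"])
    then have "x - z \<in> interior C" using t by (simp add: algebra_simps)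
    then have "z + (x - z) \<in> interior K" using zK by blast
    then show False using x by (simp add: frontier_def)
  qed
  moreover have "y + v \<in> interior C"
    using C x t by (auto intro: convex_cone_add_interior convex_cone_scaleR)
  moreover have "norm y < R"
    using t x(3) mult_left_le_one_le[of "norm x" t] by simp
  ultimately show "y \<in> boundary_layer C v z R" by (simp add: boundary_layer_def)
qed

section \<open>Choice of the constant and the cone-volume estimate\<close>

theorem theorem1:
  fixes C K :: "'a::euclidean_space set" and v :: 'a
  assumes "DIM('a) \<ge> 2"
    and "closed C" and "convex_cone C" and "pointed C" and "interior C \<noteq> {}"
    and "norm v = 1" and "v \<in> interior C" and "- v \<in> interior (dual_cone C)"
    and "pseudo_cone_of C K"
  shows "\<exists>c::real. 0 \<le> c \<and>
    (\<forall>\<omega>. compact \<omega> \<and> \<omega> \<subseteq> Omega_dual C \<longrightarrow>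
       cone_volume K \<omega> \<le> ennreal c / boundary_angle C \<omega> ^ (DIM('a) - 1))"
proof -
  have K: "pseudo_cone K" "recession_cone K = C"
    using assms(9) by (auto simp: pseudo_cone_of_def)
  have KC: "K \<subseteq> C" using pseudo_cone_subset_recession_cone[OF K(1)] K(2) by simp
  obtain z where z: "z \<in> K" using K(1) by (auto simp: pseudo_cone_def)
  have clK: "closed K" using K(1) by (simp add: pseudo_cone_def)
  obtain a where a: "a \<ge> 0"
    "\<And>R. R \<ge> 1 \<Longrightarrow> emeasure lborel (boundary_layer C v z R) \<le> ennreal (a * R ^ (DIM('a) - 1))"
    using emeasure_boundary_layer_le[OF assms(2,3,7,6)] by metis
  define b where "b = unit_ball_vol (real DIM('a)) * real DIM('a) ^ DIM('a)"
  have b: "b \<ge> 0" by (simp add: b_def)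
  \<comment> \<open>The term \<open>8 * norm z\<close> comes from the bound
    \<open>\<Delta> / 8 * norm x <= norm z\<close>. The summand 4 makes
    \<open>norm x < P / \<Delta>\<close> strict and ensures \<open>R >= 1\<close>, since
    \<open>\<Delta> < 4\<close>.\<close>
  define P where "P = 8 * norm z + 4"
  have P: "P > 0" by (simp add: P_def add_nonneg_pos)
  \<comment> \<open>The summand 1 makes \<open>c\<close> positive, so that \<open>c / 0\<close> is
    \<open>top\<close> when the boundary angle vanishes; in \<open>ennreal\<close>,
    \<open>0 / 0\<close> would be 0.\<close>
  define c where "c = b * a * P ^ (DIM('a) - 1) + 1"
  have c: "c > 0" using a b P by (simp add: c_def add_nonneg_pos)
  have "cone_volume K \<omega> \<le> ennreal c / boundary_angle C \<omega> ^ (DIM('a) - 1)"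
    if w: "\<omega> \<subseteq> Omega_dual C" for \<omega>
  proof (cases "\<omega> = {} \<or> boundary_angle C \<omega> = 0")
    case True
    then show ?thesis
    proof
      assume "\<omega> = {}"
      then show ?thesis by (simp add: cone_volume_def reverse_gauss_image_def)
    next
      assume "boundary_angle C \<omega> = 0"
      then have "boundary_angle C \<omega> ^ (DIM('a) - 1) = 0" using assms(1) by simp
      moreover have "ennreal c / 0 = top" using c by (simp add: ennreal_divide_zero)
      ultimately show ?thesis by (simp only: top_greatest)
    qed
  next
    case False
    then obtain u0 where u0: "u0 \<in> \<omega>" by blast
    have le_pi: "boundary_angle C \<omega> \<le> ennreal pi"
      using boundary_angle_le_pi[OF assms(1) u0 w _ assms(6)] assms(7) interior_subset by blast
    then obtain \<Delta> where D: "boundary_angle C \<omega> = ennreal \<Delta>" "\<Delta> \<ge> 0"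
      by (cases "boundary_angle C \<omega>") (auto simp: top_unique)
    have D0: "\<Delta> > 0" using D False by (cases "\<Delta> = 0") auto
    have D4: "\<Delta> < 4" using le_pi D pi_less_4 pi_gt_zero by (auto simp: ennreal_le_iff2)
    define R where "R = P / \<Delta>"
    have R: "R \<ge> 1"
    proof -
      have "\<Delta> \<le> P" using D4 by (simp add: P_def add_increasing)
      then show ?thesis using D0 by (simp add: R_def)
    qed
    have seg: "closed_segment 0 x \<subseteq> boundary_layer C v z R"
      if x: "x \<in> reverse_gauss_image K \<omega>" for x
    proof -
      define u where "u = gauss_map K x"
      have xu: "x \<in> frontier K" "u \<in> \<omega>" "outer_unit_normal K x u"
        using x theI'[of "outer_unit_normal K x"]
        by (auto simp: reverse_gauss_image_def u_def gauss_map_def)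
      have xC: "x \<in> C" using xu(1) clK KC frontier_subset_closed by blast
      \<comment> \<open>The radius is \<open>\<Delta> / 4\<close>: four times it is exactly the
        boundary angle, and it is below 1 because \<open>\<Delta> < 4\<close>.\<close>
      have "ball u (2 * (\<Delta> / 8)) \<subseteq> dual_cone C"
        by (rule ball_subset_dual_cone[OF xu(2) w]) (use D D4 in auto)
      then have "\<Delta> / 8 * norm x \<le> norm z"
        using D0 xu(3) z by (intro norm_le_of_ball_subset_dual_cone[OF xC])
          (auto simp: outer_unit_normal_def)
      then have "norm x < R" using D0 by (simp add: R_def P_def field_simps)
      then show ?thesis
        using closed_segment_subset_boundary_layer[OF assms(3,7) K(2) z xu(1) xC] by blast
    qed
    have "cone_volume K \<omega> \<le> ennreal b * emeasure lborel (boundary_layer C v z R)"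
      unfolding cone_volume_def b_def
      by (rule hausdorff_measure_le_lborel)
         (use seg open_boundary_layer[OF assms(2)]
            bounded_subset[OF bounded_ball boundary_layer_subset_ball] in blast)+
    also have "\<dots> \<le> ennreal b * ennreal (a * R ^ (DIM('a) - 1))"
      by (intro mult_left_mono a R) auto
    also have "\<dots> = ennreal (b * a * P ^ (DIM('a) - 1) / \<Delta> ^ (DIM('a) - 1))"
      using b by (simp add: ennreal_mult'[symmetric] R_def power_divide mult_ac)
    also have "\<dots> \<le> ennreal (c / \<Delta> ^ (DIM('a) - 1))"
      using D0 by (intro ennreal_leI divide_right_mono) (auto simp: c_def)
    also have "\<dots> = ennreal c / boundary_angle C \<omega> ^ (DIM('a) - 1)"
      using D0 c by (simp add: D(1) ennreal_power divide_ennreal)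
    finally show ?thesis .
  qed
  then show ?thesis using c by (intro exI[of _ c]) auto
qed

end
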